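(* Let $X_1,\dots,X_n$ be dependent random variables sharing an Archimedean copula with generator $\psi_1$, with $X_i\sim LS(\lambda_i,\sigma_i,F)$, $i=1,\dots,n$. Let $Y_1,\dots,Y_n$ be dependent random variables sharing an Archimedean copula with generator $\psi_2$, with $Y_i\sim LS(\lambda_i,\xi_i,G)$, $i=1,\dots,n$. Assume that $\boldsymbol{\lambda},\boldsymbol{\sigma},\boldsymbol{\xi}$ all belong to $\mathcal{D}_+$ (or all belong to $\mathcal{E}_+$). Suppose that $\phi_2\circ\psi_1$ is super-additive, that $\psi_1$ or $\psi_2$ is log-convex, and that $X\geq_{st}Y$. Then: (i) $\frac{1}{\boldsymbol{\sigma}}\stackrel{p}{\succeq}\frac{1}{\boldsymbol{\xi}}\Rightarrow X_{n:n}\geq_{st}Y_{n:n}$, if either $u\,\tilde r_X(u)$ or $u\,\tilde r_Y(u)$ is decreasing in $u$; (ii) $\frac{1}{\boldsymbol{\sigma}}\stackrel{rm}{\succeq}\frac{1}{\boldsymbol{\xi}}\Rightarrow X_{n:n}\geq_{st}Y_{n:n}$, if either $u^2\tilde r_X(u)$ or $u^2\tilde r_Y(u)$ is decreasing in $u$.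
   Context: Location-scale family: a random variable follows $LS(\lambda,\sigma,F)$, $\lambda\in\mathbb{R}$, $\sigma>0$, if its distribution function is $x\mapsto F\left(\frac{x-\lambda}{\sigma}\right)$ for $x>\lambda$, where $F$ is a baseline distribution function (so only arguments $u>0$ of the baseline functions matter). $X$ and $Y$ are absolutely continuous random variables with distribution functions $F$ and $G$ and densities $f$ and $g$; their reversed hazard rates are $\tilde r_X=f/F$ and $\tilde r_Y=g/G$. $\boldsymbol{\lambda}=(\lambda_1,\dots,\lambda_n)$, $\boldsymbol{\sigma}=(\sigma_1,\dots,\sigma_n)$, $\boldsymbol{\xi}=(\xi_1,\dots,\xi_n)$, and $\frac1{\boldsymbol{\sigma}}=(1/\sigma_1,\dots,1/\sigma_n)$, similarly $\frac1{\boldsymbol{\xi}}$. Copulas: a generator is $\psi:[0,\infty]\to[0,1]$ with $\psi(0)=1$, $\psi(\infty)=0$ that is $n$-monotone, i.e. $(-1)^k\psi^{(k)}\ge 0$ for $k=0,\dots,n-2$ and $(-1)^{n-2}\psi^{(n-2)}$ is decreasing and convex; the Archimedean copula is $C_\psi(u_1,\dots,u_n)=\psi\left(\sum_{k=1}^n\psi^{-1}(u_k)\right)$. Write $\phi_i=\psi_i^{-1}$ (right-continuous inverse). The $X_k$ have joint distribution function $P(X_1\le x_1,\dots,X_n\le x_n)=\psi_1\left(\sum_k\phi_1(P(X_k\le x_k))\right)$, and similarly for the $Y_k$ with $\psi_2,\phi_2$; thus for $t>\max_k\lambda_k$ the distribution function of $X_{n:n}$ is $\psi_1\left[\sum_{k=1}^n\phi_1\left\{F\left(\frac{t-\lambda_k}{\sigma_k}\right)\right\}\right]$.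 A function $f$ is super-additive if $f(x+y)\ge f(x)+f(y)$ for all $x,y$ in its domain. $X_{n:n}=\max_i X_i$, $Y_{n:n}=\max_i Y_i$. $U\geq_{st}V$ means $P(U\le t)\le P(V\le t)$ for all $t$. $\mathcal{D}_+=\{\mathbf{x}: x_1\ge x_2\ge\dots\ge x_n>0\}$, $\mathcal{E}_+=\{\mathbf{x}: 0<x_1\le x_2\le\dots\le x_n\}$. With $x_{(1)}\le\dots\le x_{(n)}$ the increasing arrangement of a positive vector, $\mathbf{x}\stackrel{p}{\succeq}\mathbf{y}$ means $\prod_{i=1}^j x_{(i)}\le\prod_{i=1}^j y_{(i)}$ for $j=1,\dots,n$; $\mathbf{x}\stackrel{rm}{\succeq}\mathbf{y}$ means $\sum_{i=1}^j \frac1{x_{(i)}}\ge\sum_{i=1}^j\frac1{y_{(i)}}$ for $j=1,\dots,n$. *)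

theory Defs
  imports "HOL-Probability.Probability"
begin

definition st_ge :: "'a measure \<Rightarrow> ('a \<Rightarrow> real) \<Rightarrow> 'b measure \<Rightarrow> ('b \<Rightarrow> real) \<Rightarrow> bool" where
  "st_ge M U N V \<longleftrightarrow> (\<forall>t. cdf (distr M borel U) t \<le> cdf (distr N borel V) t)"

text \<open>Location-scale family above the location parameter: the law lives on \<open>[l, \<infinity>)\<close>.
  The value at \<open>x = l\<close> is left to right-continuity, so that a baseline with
  \<open>F 0 > 0\<close> is not excluded.\<close>

definition LS :: "'a measure \<Rightarrow> ('a \<Rightarrow> real) \<Rightarrow> real \<Rightarrow> real \<Rightarrow> (real \<Rightarrow> real) \<Rightarrow> bool" where
  "LS M U l s F \<longleftrightarrow> U \<in> borel_measurable M \<and> s > 0 \<and>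
     (\<forall>x>l. cdf (distr M borel U) x = F ((x - l) / s)) \<and>
     (\<forall>x<l. cdf (distr M borel U) x = 0)"

definition rev_hazard :: "(real \<Rightarrow> real) \<Rightarrow> (real \<Rightarrow> real) \<Rightarrow> real \<Rightarrow> real" where
  "rev_hazard f F u = f u / F u"

text \<open>Derivatives are taken on the open half-line, because they may be infinite at \<open>0\<close>.
  The definition is meant for \<open>n \<ge> 2\<close>.\<close>

definition n_monotone :: "nat \<Rightarrow> (real \<Rightarrow> real) \<Rightarrow> bool" where
  "n_monotone n g \<longleftrightarrow>
     (\<forall>k<n - 2. \<forall>x>0. (deriv ^^ k) g differentiable (at x)) \<and>
     (\<forall>k\<le>n - 2. \<forall>x>0. 0 \<le> (-1) ^ k * (deriv ^^ k) g x) \<and>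
     antimono_on {0<..} (\<lambda>x. (-1) ^ (n - 2) * (deriv ^^ (n - 2)) g x) \<and>
     convex_on {0<..} (\<lambda>x. (-1) ^ (n - 2) * (deriv ^^ (n - 2)) g x)"

text \<open>Type \<open>ennreal\<close> is exactly the domain \<open>[0, \<infinity>]\<close> of a generator. Continuity is the usual
  part of \<open>n\<close>-monotonicity on a closed half-line at \<open>0\<close>, and at \<open>\<infinity>\<close> it says
  that \<open>\<psi> \<infinity> = 0\<close> is a limit.\<close>

definition archimedean_generator :: "nat \<Rightarrow> (ennreal \<Rightarrow> real) \<Rightarrow> bool" where
  "archimedean_generator n \<psi> \<longleftrightarrow> range \<psi> \<subseteq> {0..1} \<and> \<psi> 0 = 1 \<and> \<psi> \<infinity> = 0 \<and>
     continuous_on UNIV \<psi> \<and> n_monotone n (\<lambda>x. \<psi> (ennreal x))"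

text \<open>The right-continuous inverse. For a generator that vanishes from a finite point on, its
  value at \<open>0\<close> is the least such point; otherwise it is \<open>\<infinity>\<close>.\<close>

definition gen_inv :: "(ennreal \<Rightarrow> real) \<Rightarrow> real \<Rightarrow> ennreal" where
  "gen_inv \<psi> u = Inf {s. \<psi> s \<le> u}"

definition archimedean_copula :: "nat \<Rightarrow> (ennreal \<Rightarrow> real) \<Rightarrow> (nat \<Rightarrow> real) \<Rightarrow> real" where
  "archimedean_copula n \<psi> u = \<psi> (\<Sum>k=1..n. gen_inv \<psi> (u k))"

definition has_archimedean_copula ::
    "'a measure \<Rightarrow> nat \<Rightarrow> (nat \<Rightarrow> 'a \<Rightarrow> real) \<Rightarrow> (ennreal \<Rightarrow> real) \<Rightarrow> bool" where
  "has_archimedean_copula M n U \<psi> \<longleftrightarrow>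
     (\<forall>x :: nat \<Rightarrow> real. measure M {w \<in> space M. \<forall>k\<in>{1..n}. U k w \<le> x k} =
        archimedean_copula n \<psi> (\<lambda>k. cdf (distr M borel (U k)) (x k)))"

definition super_additive :: "(ennreal \<Rightarrow> ennreal) \<Rightarrow> bool" where
  "super_additive h \<longleftrightarrow> (\<forall>x y. h x + h y \<le> h (x + y))"

text \<open>Positivity is required explicitly, since \<open>ln 0 = 0\<close> by convention.\<close>

definition log_convex_on :: "real set \<Rightarrow> (real \<Rightarrow> real) \<Rightarrow> bool" where
  "log_convex_on S g \<longleftrightarrow> (\<forall>x\<in>S. 0 < g x) \<and> convex_on S (\<lambda>x. ln (g x))"

text \<open>Vectors of length \<open>n\<close> are functions read at the indices \<open>1, \<dots>, n\<close> only.\<close>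

definition D_plus :: "nat \<Rightarrow> (nat \<Rightarrow> real) set" where
  "D_plus n = {x. antimono_on {1..n} x \<and> (\<forall>i\<in>{1..n}. 0 < x i)}"

definition E_plus :: "nat \<Rightarrow> (nat \<Rightarrow> real) set" where
  "E_plus n = {x. mono_on {1..n} x \<and> (\<forall>i\<in>{1..n}. 0 < x i)}"

definition order_stat :: "nat \<Rightarrow> (nat \<Rightarrow> real) \<Rightarrow> nat \<Rightarrow> real" where
  "order_stat n x i = sort (map x [1..<n + 1]) ! (i - 1)"

definition p_larger :: "nat \<Rightarrow> (nat \<Rightarrow> real) \<Rightarrow> (nat \<Rightarrow> real) \<Rightarrow> bool" where
  "p_larger n x y \<longleftrightarrow>
     (\<forall>j\<in>{1..n}. (\<Prod>i=1..j. order_stat n x i) \<le> (\<Prod>i=1..j. order_stat n y i))"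

definition rm_larger :: "nat \<Rightarrow> (nat \<Rightarrow> real) \<Rightarrow> (nat \<Rightarrow> real) \<Rightarrow> bool" where
  "rm_larger n x y \<longleftrightarrow>
     (\<forall>j\<in>{1..n}. (\<Sum>i=1..j. 1 / order_stat n x i) \<ge> (\<Sum>i=1..j. 1 / order_stat n y i))"

definition sample_max :: "nat \<Rightarrow> (nat \<Rightarrow> 'a \<Rightarrow> real) \<Rightarrow> 'a \<Rightarrow> real" where
  "sample_max n U w = Max ((\<lambda>i. U i w) ` {1..n})"

end

theory Submission
  imports Defs
begin

text \<open>For \<open>t\<close> above all locations put \<open>a k = t - l k\<close>, \<open>z k = 1 / \<sigma> k\<close>, \<open>w k = 1 / \<xi> k\<close>,
and write \<open>C\<psi>(u)\<close> for the Archimedean copula. The claim is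
\<open>C\<psi>1(F (a k * z k)) \<le> C\<psi>2(G (a k * w k))\<close>; for other \<open>t\<close> the left side of the desired comparison is
zero, or right-continuity of distribution functions applies.

Super-additivity of \<open>gen_inv \<psi>2 \<circ> \<psi>1\<close> gives \<open>C\<psi>1 \<le> C\<psi>2\<close>
(\<open>archimedean_copula_le_of_super_additive\<close>), every \<open>C\<psi>\<close> is increasing in each argument, and
\<open>F \<le> G\<close>. Both the copula and the baseline can therefore be changed at either end of the chain, and
it is enough to compare the scale vectors for one pair \<open>(\<psi>, H)\<close>, where \<open>\<psi>\<close> is the log-convex
generator and \<open>H\<close> is the baseline with decreasing weighted reversed hazard rate:
\<open>C\<psi>(H (a k * z k)) \<le> C\<psi>(H (a k * w k))\<close>, that is,
\<open>\<Sum> K (ln (H (a k * z k))) \<ge> \<Sum> K (ln (H (a k * w k)))\<close> with \<open>K v = gen_inv \<psi> (exp v)\<close>.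

Two tangent inequalities prove this. The function \<open>K\<close> is the inverse of the convex decreasing
\<open>ln \<circ> \<psi>\<close>, hence convex and decreasing (\<open>gen_inv_exp_convex\<close>), so it has an increasing nonpositive
subgradient. The weight \<open>u\<close> or \<open>u\<^sup>2\<close> makes \<open>ln \<circ> H\<close> concave as a function of
\<open>\<theta> u = ln u\<close> or \<open>\<theta> u = - 1 / u\<close> (\<open>ln_tangent\<close>). Composed, they bound the difference of the two
sums from below by \<open>\<Sum> d k * (y k - x k)\<close>, where \<open>x, y\<close> are \<open>ln z, ln w\<close> or
\<open>- 1 / z, - 1 / w\<close>. For increasing \<open>a, z, w\<close> the coefficients \<open>d k\<close> are nonnegative and decreasing, and
the order hypothesis says that the partial sums of \<open>y - x\<close> are nonnegative; summation by parts
finishes the proof (\<open>archimedean_copula_le_of_partial_sums\<close>). Decreasing vectors are reduced to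
increasing ones by reversing the indices.\<close>

section \<open>Concavity of the logarithm of a distribution function\<close>

text \<open>The sign of \<open>u\<close> is free. This lets the inequality serve for \<open>H\<close> and for \<open>- H\<close>, which turns lower
bounds on growth into upper ones.\<close>

lemma gronwall_integral:
  fixes u v \<Theta> :: "real \<Rightarrow> real"
  assumes "a \<le> b" and u: "continuous_on {a..b} u" and v: "continuous_on {a..b} v"
    and v0: "\<And>x. x \<in> {a..b} \<Longrightarrow> 0 \<le> v x"
    and \<Theta>: "\<And>x. x \<in> {a..b} \<Longrightarrow> (\<Theta> has_real_derivative v x) (at x)"
    and le: "\<And>x. x \<in> {a..b} \<Longrightarrow> u x \<le> u a + integral {a..x} (\<lambda>t. v t * u t)"
  shows "u b \<le> u a * exp (\<Theta> b - \<Theta> a)"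
proof -
  define J where "J x = integral {a..x} (\<lambda>t. v t * u t)" for x
  have cont: "continuous_on {a..b} (\<lambda>t. v t * u t)"
    by (intro continuous_intros u v)
  have J: "(J has_real_derivative v x * u x) (at x within {a..b})" if "x \<in> {a..b}" for x
    unfolding J_def by (rule integral_has_real_derivative[OF cont that])
  \<comment> \<open>The integrating factor turns the integral inequality into monotonicity of \<open>E\<close>.\<close>
  define E where "E x = (u a + J x) * exp (- \<Theta> x)" for x
  have "E b \<le> E a"
  proof (rule DERIV_nonpos_imp_decreasing_open[OF \<open>a \<le> b\<close>])
    fix x assume x: "a < x" "x < b"
    then have "(J has_real_derivative v x * u x) (at x)"
      using J[of x] by (simp add: at_within_Icc_at)
    moreover have "(\<Theta> has_real_derivative v x) (at x)" using \<Theta> x by simp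
    ultimately have "(E has_real_derivative v x * (u x - (u a + J x)) * exp (- \<Theta> x)) (at x)"
      unfolding E_def by (auto intro!: derivative_eq_intros simp: algebra_simps)
    moreover have "v x * (u x - (u a + J x)) * exp (- \<Theta> x) \<le> 0"
      using v0[of x] le[of x] x by (simp add: J_def mult_nonneg_nonpos mult_nonpos_nonneg)
    ultimately show "\<exists>y. DERIV E x :> y \<and> y \<le> 0" by blast
  next
    have "continuous_on {a..b} J"
      using J by (rule DERIV_continuous_on)
    moreover have "continuous_on {a..b} \<Theta>"
      using \<Theta> by (meson DERIV_isCont continuous_at_imp_continuous_on)
    ultimately show "continuous_on {a..b} E"
      unfolding E_def by (intro continuous_intros)
  qed
  then have "(u a + J b) * exp (- \<Theta> b) \<le> u a * exp (- \<Theta> a)"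
    by (simp add: E_def J_def)
  moreover have "u b * exp (- \<Theta> b) \<le> (u a + J b) * exp (- \<Theta> b)"
    using le[of b] \<open>a \<le> b\<close> by (simp add: J_def)
  ultimately have "u b * exp (- \<Theta> b) \<le> u a * exp (- \<Theta> a)" by linarith
  then have "u b * exp (- \<Theta> b) * exp (\<Theta> b) \<le> u a * exp (- \<Theta> a) * exp (\<Theta> b)"
    by (rule mult_right_mono) simp
  then show ?thesis by (simp add: mult.assoc flip: exp_add)
qed

text \<open>A density only enters through its integrals over intervals, but it is a fixed function: monotonicity
of the reversed hazard rate is a pointwise condition on it.\<close>
locale distribution_with_density =
  fixes h H :: "real \<Rightarrow> real"
  assumes density_nonneg: "0 \<le> h u"
    and bounds: "H u \<in> {0..1}"
    and increment: "a \<le> b \<Longrightarrow> (h has_integral H b - H a) {a..b}"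
begin

lemma mono_H: "mono H"
proof (rule monoI)
  fix x y :: real assume "x \<le> y"
  then show "H x \<le> H y"
    using has_integral_nonneg[OF increment] density_nonneg by fastforce
qed

text \<open>Formally \<open>(ln \<circ> H)' = R * \<theta>'\<close> with \<open>R = w * rev_hazard h H\<close>, so decreasing \<open>R\<close> makes
\<open>ln \<circ> H\<close> concave as a function of \<open>\<theta>\<close>, and \<open>R p\<close> is its slope at \<open>p\<close>. The density need not be
continuous, hence \<open>H\<close> need not be differentiable; the integral form of Gronwall's inequality with
the constant \<open>R p\<close> in place of \<open>R\<close> gives the tangent inequality without differentiating \<open>H\<close>.\<close>
lemma ln_tangent:
  fixes w \<theta> :: "real \<Rightarrow> real"
  assumes \<theta>: "\<And>u. 0 < u \<Longrightarrow> (\<theta> has_real_derivative 1 / w u) (at u)"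
    and w0: "\<And>u. 0 < u \<Longrightarrow> 0 < w u" and w: "continuous_on {0<..} w"
    and anti: "antimono_on {u. 0 < u \<and> 0 < H u} (\<lambda>u. w u * rev_hazard h H u)"
    and p: "0 < p" "0 < H p" and q: "0 < q" "0 < H q"
  shows "ln (H q) - ln (H p) \<le> w p * rev_hazard h H p * (\<theta> q - \<theta> p)"
proof -
  define R where "R u = w u * rev_hazard h H u" for u
  define c where "c = R p"
  have R: "R y \<le> R x" if "0 < x" "0 < H x" "x \<le> y" "0 < H y" for x y
    using monotone_onD[OF anti, of x y] that by (simp add: R_def)
  have mono: "H x \<le> H y" if "x \<le> y" for x y
    using monoD[OF mono_H that] .
  have c0: "0 \<le> c"
    using p w0[of p] density_nonneg[of p] by (simp add: c_def R_def rev_hazard_def)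
  have h_eq: "h x = R x * (1 / w x) * H x" if "0 < x" "0 < H x" for x
    using that w0[of x] by (simp add: R_def rev_hazard_def)
  have contH: "continuous_on {a..b} H" if "a \<le> b" for a b
  proof -
    have "continuous_on {a..b} (\<lambda>x. H a + integral {a..x} h)"
      using increment[OF that] by (intro continuous_intros indefinite_integral_continuous_1) auto
    moreover have "H a + integral {a..x} h = H x" if "x \<in> {a..b}" for x
      using increment[of a x] that by (simp add: integral_unique)
    ultimately show ?thesis by (rule continuous_on_eq)
  qed
  have contv: "continuous_on {a..b} (\<lambda>x. c * (1 / w x))" if "0 < a" for a b
  proof -
    have "w x \<noteq> 0" if "x \<in> {a..b}" for x
      using w0[of x] that \<open>0 < a\<close> by simp
    moreover have "continuous_on {a..b} w"
      by (rule continuous_on_subset[OF w]) (use that in auto)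
    ultimately show ?thesis by (intro continuous_intros) auto
  qed
  have d\<theta>: "((\<lambda>x. c * \<theta> x) has_real_derivative c * (1 / w x)) (at x)" if "0 < x" for x
    using \<theta>[OF that] by (rule DERIV_cmult)
  have int: "(\<lambda>t. c * (1 / w t) * H t) integrable_on {a..x}" if "0 < a" "a \<le> x" for a x
    by (intro integrable_continuous_real continuous_on_mult contv contH that)
  show ?thesis
  proof (cases "p \<le> q")
    case True
    have Hpos: "0 < H x" if "p \<le> x" for x using mono[OF that] p by simp
    have "H q \<le> H p * exp (c * \<theta> q - c * \<theta> p)"
    proof (rule gronwall_integral[where v = "\<lambda>x. c * (1 / w x)"])
      fix x assume x: "x \<in> {p..q}"
      have "H x - H p \<le> integral {p..x} (\<lambda>t. c * (1 / w t) * H t)"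
      proof (rule has_integral_le[OF increment integrable_integral[OF int]])
        fix t assume t: "t \<in> {p..x}"
        then show "h t \<le> c * (1 / w t) * H t"
          using R[of p t] Hpos[of t] p w0[of t]
          by (subst h_eq) (auto simp: c_def divide_right_mono mult_right_mono)
      qed (use x p in auto)
      then show "H x \<le> H p + integral {p..x} (\<lambda>t. c * (1 / w t) * H t)" by simp
      show "0 \<le> c * (1 / w x)" using c0 w0[of x] x p by simp
      show "((\<lambda>x. c * \<theta> x) has_real_derivative c * (1 / w x)) (at x)"
        using d\<theta>[of x] x p by simp
    qed (use True p contv contH in auto)
    then have "ln (H q) \<le> ln (H p * exp (c * \<theta> q - c * \<theta> p))"
      using p q by (subst ln_le_cancel_iff) auto
    then show ?thesis
      using p by (simp add: ln_mult c_def R_def algebra_simps)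
  next
    case False
    then have qp: "q \<le> p" by simp
    have Hpos: "0 < H x" if "q \<le> x" for x using mono[OF that] q by simp
    \<comment> \<open>To the left of \<open>p\<close> the constant is a lower bound of \<open>R\<close>, so \<open>- H\<close> is started from \<open>q\<close>.\<close>
    have "- H p \<le> - H q * exp (c * \<theta> p - c * \<theta> q)"
    proof (rule gronwall_integral[where v = "\<lambda>x. c * (1 / w x)"])
      fix x assume x: "x \<in> {q..p}"
      have "integral {q..x} (\<lambda>t. c * (1 / w t) * H t) \<le> H x - H q"
      proof (rule has_integral_le[OF integrable_integral[OF int] increment])
        fix t assume t: "t \<in> {q..x}"
        then show "c * (1 / w t) * H t \<le> h t"
          using R[of t p] Hpos[of t] p q x w0[of t]
          by (subst h_eq) (auto simp: c_def divide_right_mono mult_right_mono)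
      qed (use x q in auto)
      then show "- H x \<le> - H q + integral {q..x} (\<lambda>t. c * (1 / w t) * - H t)" by simp
      show "0 \<le> c * (1 / w x)" using c0 w0[of x] x q by simp
      show "((\<lambda>x. c * \<theta> x) has_real_derivative c * (1 / w x)) (at x)"
        using d\<theta>[of x] x q by simp
    qed (use qp q contv contH in \<open>auto intro!: continuous_intros\<close>)
    then have "ln (H q * exp (c * \<theta> p - c * \<theta> q)) \<le> ln (H p)"
      using p q by (subst ln_le_cancel_iff) auto
    then show ?thesis
      using q by (simp add: ln_mult c_def R_def algebra_simps)
  qed
qed

end

lemma distribution_with_density_cdf:
  assumes P: "prob_space P" and f0: "\<And>u. 0 \<le> f u"
    and dist: "distributed P lborel X (\<lambda>u. ennreal (f u))"
  shows "distribution_with_density f (cdf (distr P borel X))"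
proof -
  let ?D = "distr P borel X"
  have X: "X \<in> borel_measurable P"
    using distributed_measurable[OF dist] by simp
  have f: "f \<in> borel_measurable borel"
    using distributed_real_measurable[OF _ dist] f0 by simp
  interpret D: real_distribution ?D
    using prob_space.real_distribution_distr[OF P X] .
  have "distr P borel X = distr P lborel X"
    by (rule distr_cong) auto
  then have D: "?D = density lborel (\<lambda>u. ennreal (f u))"
    using distributed_distr_eq_density[OF dist] by simp
  show ?thesis
  proof
    fix a b :: real assume "a \<le> b"
    have "measure ?D {a<..b} = cdf ?D b - cdf ?D a"
      using \<open>a \<le> b\<close> D.cdf_diff_eq[of a b] by (cases "a = b") auto
    moreover have "emeasure ?D {a<..b} = (\<integral>\<^sup>+x. ennreal (f x) * indicator {a<..b} x \<partial>lborel)"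
      unfolding D using f by (subst emeasure_density) auto
    ultimately have "(\<integral>\<^sup>+x. ennreal (f x * indicator {a<..b} x) \<partial>lborel)
        = ennreal (cdf ?D b - cdf ?D a)"
      by (simp add: D.emeasure_eq_measure ennreal_mult' f0 flip: ennreal_indicator)
    then have "((\<lambda>x. f x * indicator {a<..b} x) has_integral cdf ?D b - cdf ?D a) UNIV"
      using f f0 D.cdf_nondecreasing[OF \<open>a \<le> b\<close>]
      by (intro nn_integral_has_integral) auto
    moreover have "(\<lambda>x. f x * indicator {a<..b} x) = (\<lambda>x. if x \<in> {a<..b} then f x else 0)"
      by (auto simp: indicator_def)
    ultimately have "(f has_integral cdf ?D b - cdf ?D a) {a<..b}"
      using has_integral_restrict_UNIV[of "{a<..b}" f] by simp
    moreover have "(f has_integral i) {a<..b} = (f has_integral i) {a..b}" for i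
    proof (rule has_integral_spike_set_eq)
      show "negligible {x \<in> {a<..b} - {a..b}. f x \<noteq> 0}"
        by (rule negligible_subset[of "{a}"]) auto
      show "negligible {x \<in> {a..b} - {a<..b}. f x \<noteq> 0}"
        by (rule negligible_subset[of "{a}"]) auto
    qed
    ultimately show "(f has_integral cdf ?D b - cdf ?D a) {a..b}" by simp
  qed (use f0 D.cdf_nonneg D.cdf_bounded_prob in auto)
qed

section \<open>Convexity and summation by parts\<close>

text \<open>The supremum of the slopes of chords from the left is a subgradient at every point, the right end
point \<open>b\<close> included. This matters for \<open>b = 0\<close>: the logarithm of a distribution function may
reach \<open>0\<close>.\<close>
lemma convex_decreasing_subgradient:
  fixes K :: "real \<Rightarrow> real"
  assumes conv: "convex_on {..b} K" and anti: "antimono_on {..b} K"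
  obtains c where "\<And>v. v \<le> b \<Longrightarrow> c v \<le> 0" "mono_on {..b} c"
    "\<And>v s. v \<le> b \<Longrightarrow> s \<le> b \<Longrightarrow> c v * (s - v) \<le> K s - K v"
proof -
  define sl where "sl r s = (K s - K r) / (s - r)" for r s
  define c where "c v = (SUP r\<in>{..<v}. sl r v)" for v
  have sl0: "sl r s \<le> 0" if "r < s" "s \<le> b" for r s
    using monotone_onD[OF anti, of r s] that by (simp add: sl_def divide_nonpos_pos)
  have three: "sl r s \<le> sl s t" if "r < s" "s < t" "t \<le> b" for r s t
  proof -
    have "(K r - K s) / (r - s) \<le> (K s - K t) / (s - t)"
      using convex_on_slope_le[OF conv, of r t s] that
      by (force simp: convex_on_slope_le)
    then show ?thesis
      unfolding sl_def by (metis minus_diff_eq minus_divide_divide)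
  qed
  have bdd: "bdd_above ((\<lambda>r. sl r v) ` {..<v})" if "v \<le> b" for v
    using sl0 that by (intro bdd_aboveI[of _ 0]) auto
  have left: "sl r v \<le> c v" if "r < v" "v \<le> b" for r v
    unfolding c_def using that bdd by (intro cSUP_upper) auto
  have right: "c v \<le> sl v s" if "v < s" "s \<le> b" for v s
    unfolding c_def using that three by (intro cSUP_least) auto
  show thesis
  proof
    show "c v \<le> 0" if "v \<le> b" for v
      unfolding c_def using that sl0 by (intro cSUP_least) auto
    show "mono_on {..b} c"
    proof (rule mono_onI)
      fix r s assume "r \<in> {..b}" "s \<in> {..b}" "r \<le> s"
      then show "c r \<le> c s"
        using right[of r s] left[of r s] by (cases "r = s") auto
    qed
    show "c v * (s - v) \<le> K s - K v" if "v \<le> b" "s \<le> b" for v s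
    proof (cases s v rule: linorder_cases)
      case less
      then show ?thesis using left[of s v] that by (simp add: sl_def field_simps)
    next
      case greater
      then show ?thesis using right[of v s] that by (simp add: sl_def field_simps)
    qed simp
  qed
qed

text \<open>Summation by parts: the sum is at least its last weight times the last partial sum, by induction.\<close>
lemma sum_mult_nonneg_of_partial_sums:
  fixes d e :: "nat \<Rightarrow> real"
  assumes anti: "antimono_on {1..n} d" and d0: "\<And>i. i \<in> {1..n} \<Longrightarrow> 0 \<le> d i"
    and e: "\<And>j. j \<in> {1..n} \<Longrightarrow> 0 \<le> (\<Sum>i=1..j. e i)"
  shows "0 \<le> (\<Sum>i=1..n. d i * e i)"
proof (cases "n = 0")
  case False
  have "d m * (\<Sum>i=1..m. e i) \<le> (\<Sum>i=1..m. d i * e i)" if "1 \<le> m" "m \<le> n" for m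
    using that
  proof (induction m rule: dec_induct)
    case (step m)
    have "d (Suc m) * (\<Sum>i=1..m. e i) \<le> d m * (\<Sum>i=1..m. e i)"
      using step monotone_onD[OF anti, of m "Suc m"] by (intro mult_right_mono e) auto
    then show ?case using step by (simp add: algebra_simps)
  qed simp
  from this[of n] have "d n * (\<Sum>i=1..n. e i) \<le> (\<Sum>i=1..n. d i * e i)"
    using False by simp
  moreover have "0 \<le> d n * (\<Sum>i=1..n. e i)"
    using False by (intro mult_nonneg_nonneg d0 e) auto
  ultimately show ?thesis by linarith
qed simp

section \<open>Archimedean copulas\<close>

text \<open>The case \<open>n = 2\<close> is part of \<open>n\<close>-monotonicity. For \<open>n > 2\<close> the sign condition on the first
derivative is used.\<close>
lemma archimedean_generator_antimono:
  assumes gen: "archimedean_generator n \<psi>" and "n \<ge> 2"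
  shows "antimono \<psi>"
proof -
  define g where "g x = \<psi> (ennreal x)" for x
  have nm: "n_monotone n g"
    and r: "range \<psi> \<subseteq> {0..1}" and 0: "\<psi> 0 = 1" and top: "\<psi> \<infinity> = 0"
    using gen by (simp_all add: archimedean_generator_def g_def[abs_def])
  have g: "g y \<le> g x" if "0 < x" "x \<le> y" for x y
  proof (cases "n = 2")
    case True
    then have "antimono_on {0<..} g" using nm by (simp add: n_monotone_def)
    from monotone_onD[OF this, of x y] show ?thesis using that by simp
  next
    case False
    then have n: "0 < n - 2" "1 \<le> n - 2" using \<open>n \<ge> 2\<close> by auto
    have "g differentiable at z" if "z > 0" for z
      using nm n(1) that unfolding n_monotone_def by (metis funpow_0)
    moreover have "deriv g z \<le> 0" if "z > 0" for z
    proof -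
      have "0 \<le> (-1) ^ 1 * (deriv ^^ 1) g z"
        using nm n(2) that unfolding n_monotone_def by blast
      then show ?thesis by simp
    qed
    ultimately have d: "\<exists>d. DERIV g z :> d \<and> d \<le> 0" if "z > 0" for z
      using that DERIV_deriv_iff_real_differentiable by blast
    show ?thesis
    proof (rule DERIV_nonpos_imp_nonincreasing[OF \<open>x \<le> y\<close>])
      fix z assume "x \<le> z" "z \<le> y"
      with \<open>0 < x\<close> show "\<exists>d. DERIV g z :> d \<and> d \<le> 0" by (intro d) simp
    qed
  qed
  show ?thesis
  proof (rule antimonoI)
    fix x y :: ennreal assume xy: "x \<le> y"
    have 01: "0 \<le> \<psi> z" "\<psi> z \<le> 1" for z
      using r by (simp_all add: image_subset_iff)
    show "\<psi> y \<le> \<psi> x"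
    proof (cases "x = 0 \<or> y = \<infinity>")
      case True
      then show ?thesis using 0 top 01 by auto
    next
      case False
      then have "x < top" "y < top" using xy by (simp_all add: less_top order.strict_trans1)
      then obtain a b where ab: "x = ennreal a" "0 \<le> a" "y = ennreal b" "0 \<le> b"
        unfolding less_top_ennreal by blast
      moreover have "0 < a" using False ab by (cases "a = 0") auto
      ultimately show ?thesis using g[of a b] xy by (simp add: g_def)
    qed
  qed
qed

text \<open>Continuity makes \<open>\<psi>\<close> take the value \<open>u\<close>, and the infimum in the definition of the inverse is attained.\<close>
lemma gen_inv_right_inverse:
  assumes gen: "archimedean_generator n \<psi>" and "n \<ge> 2" and u: "u \<in> {0..1}"
  shows "\<psi> (gen_inv \<psi> u) = u"
proof (rule antisym)
  have 0: "\<psi> 0 = 1" and top: "\<psi> \<infinity> = 0" and cont: "continuous_on UNIV \<psi>"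
    using gen by (simp_all add: archimedean_generator_def)
  have "closed {s. \<psi> s \<le> u}"
    using cont by (intro closed_Collect_le continuous_intros)
  moreover have "\<infinity> \<in> {s. \<psi> s \<le> u}" using top u by simp
  ultimately have "Inf {s. \<psi> s \<le> u} \<in> {s. \<psi> s \<le> u}"
    by (intro closed_contains_Inf_cl) auto
  then show "\<psi> (gen_inv \<psi> u) \<le> u" by (simp add: gen_inv_def)
  obtain s where "\<psi> s = u"
    using IVT2'[of \<psi> \<infinity> u 0] 0 top u continuous_on_subset[OF cont] by force
  moreover have "gen_inv \<psi> u \<le> s"
    unfolding gen_inv_def using \<open>\<psi> s = u\<close> by (intro Inf_lower) simp
  ultimately show "u \<le> \<psi> (gen_inv \<psi> u)"
    using archimedean_generator_antimono[OF gen \<open>n \<ge> 2\<close>] by (auto dest: antimonoD)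
qed

lemma gen_inv_antimono: "u \<le> v \<Longrightarrow> gen_inv \<psi> v \<le> gen_inv \<psi> u"
  unfolding gen_inv_def by (intro Inf_superset_mono) auto

lemma archimedean_copula_mono:
  assumes "archimedean_generator n \<psi>" and "n \<ge> 2"
    and "\<And>k. k \<in> {1..n} \<Longrightarrow> u k \<le> v k"
  shows "archimedean_copula n \<psi> u \<le> archimedean_copula n \<psi> v"
  unfolding archimedean_copula_def
  using archimedean_generator_antimono[OF assms(1,2)] assms(3)
  by (auto intro!: antimonoD[of \<psi>] sum_mono gen_inv_antimono)

lemma super_additive_sum:
  fixes h :: "ennreal \<Rightarrow> ennreal"
  assumes "super_additive h"
  shows "finite A \<Longrightarrow> (\<Sum>k\<in>A. h (x k)) \<le> h (\<Sum>k\<in>A. x k)"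
proof (induction A rule: finite_induct)
  case (insert a A)
  have "h (x a) + (\<Sum>k\<in>A. h (x k)) \<le> h (x a) + h (\<Sum>k\<in>A. x k)"
    using insert by (intro add_left_mono)
  also have "\<dots> \<le> h (x a + (\<Sum>k\<in>A. x k))"
    using assms by (simp add: super_additive_def)
  finally show ?case using insert by simp
qed simp

text \<open>With \<open>u k = \<psi>1 (s k)\<close>, super-additivity compares \<open>gen_inv \<psi>2 (\<psi>1 (\<Sum> s k))\<close> with
\<open>\<Sum> gen_inv \<psi>2 (u k)\<close>; the decreasing \<open>\<psi>2\<close> reverses this.\<close>
lemma archimedean_copula_le_of_super_additive:
  assumes g1: "archimedean_generator n \<psi>1" and g2: "archimedean_generator n \<psi>2"
    and n: "n \<ge> 2"
    and sa: "super_additive (gen_inv \<psi>2 \<circ> \<psi>1)"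
    and u: "\<And>k. k \<in> {1..n} \<Longrightarrow> u k \<in> {0..1}"
  shows "archimedean_copula n \<psi>1 u \<le> archimedean_copula n \<psi>2 u"
proof -
  let ?s = "\<Sum>k=1..n. gen_inv \<psi>1 (u k)"
  have "(\<Sum>k=1..n. gen_inv \<psi>2 (u k)) = (\<Sum>k=1..n. (gen_inv \<psi>2 \<circ> \<psi>1) (gen_inv \<psi>1 (u k)))"
    using u gen_inv_right_inverse[OF g1 n] by (intro sum.cong) auto
  also have "\<dots> \<le> (gen_inv \<psi>2 \<circ> \<psi>1) ?s"
    by (rule super_additive_sum[OF sa]) simp
  finally have "\<psi>2 (gen_inv \<psi>2 (\<psi>1 ?s)) \<le> \<psi>2 (\<Sum>k=1..n. gen_inv \<psi>2 (u k))"
    using archimedean_generator_antimono[OF g2 n] by (auto dest: antimonoD)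
  moreover have "\<psi>1 ?s \<in> {0..1}" 
    using g1 unfolding archimedean_generator_def by blast
  ultimately show ?thesis
    unfolding archimedean_copula_def using gen_inv_right_inverse[OF g2 n] by simp
qed

lemma gen_inv_finite:
  assumes "archimedean_generator n \<psi>" and "n \<ge> 2" and "u \<in> {0<..1}"
  shows "gen_inv \<psi> u < \<infinity>"
  using gen_inv_right_inverse[OF assms(1,2), of u] assms
  by (cases "gen_inv \<psi> u = \<infinity>") (auto simp: archimedean_generator_def less_top)

text \<open>Copulas vanish on the lower boundary; this separates the case in which some inverse may be infinite.\<close>
lemma archimedean_copula_eq_0:
  assumes gen: "archimedean_generator n \<psi>" and n: "n \<ge> 2" and k: "k \<in> {1..n}" "u k = 0"
  shows "archimedean_copula n \<psi> u = 0"
proof -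
  have "gen_inv \<psi> (u k) \<le> (\<Sum>k=1..n. gen_inv \<psi> (u k))"
    using k by (intro member_le_sum) auto
  then have "archimedean_copula n \<psi> u \<le> \<psi> (gen_inv \<psi> (u k))"
    unfolding archimedean_copula_def
    using archimedean_generator_antimono[OF gen n] by (auto dest: antimonoD)
  also have "\<dots> = 0" using gen_inv_right_inverse[OF gen n, of 0] k by simp
  finally show ?thesis
    using gen unfolding archimedean_copula_def archimedean_generator_def
    by (simp add: image_subset_iff antisym)
qed

text \<open>The inverse of a convex decreasing function is convex, and \<open>v \<mapsto> gen_inv \<psi> (exp v)\<close> is the inverse
of \<open>ln \<circ> \<psi>\<close>. Since \<open>gen_inv\<close> is an infimum, it is enough that a convex combination of inverse
values belongs to the set \<open>{s. \<psi> s \<le> exp ((1 - t) * v + t * w)}\<close>.\<close>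
lemma gen_inv_exp_convex:
  assumes gen: "archimedean_generator n \<psi>" and n: "n \<ge> 2"
    and lc: "log_convex_on {0..} (\<lambda>x. \<psi> (ennreal x))"
  shows "convex_on {..0} (\<lambda>v. enn2real (gen_inv \<psi> (exp v)))" (is "convex_on _ ?K")
proof (rule convex_onI)
  fix t v w :: real assume t: "0 < t" "t < 1" and vw: "v \<in> {..0}" "w \<in> {..0}"
  have pos: "0 < \<psi> (ennreal x)" if "0 \<le> x" for x
    using lc that by (auto simp: log_convex_on_def)
  have K: "ln (\<psi> (ennreal (?K s))) = s" if "s \<in> {..0}" for s
    using gen_inv_finite[OF gen n, of "exp s"] gen_inv_right_inverse[OF gen n, of "exp s"] that
    by simp
  let ?x = "(1 - t) * ?K v + t * ?K w"
  have x0: "0 \<le> ?x" using t by simp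
  have "convex_on {0..} (\<lambda>x. ln (\<psi> (ennreal x)))"
    using lc by (simp add: log_convex_on_def)
  from convex_onD[OF this, of t "?K v" "?K w"] t
  have "ln (\<psi> (ennreal ?x)) \<le> (1 - t) * ln (\<psi> (ennreal (?K v))) + t * ln (\<psi> (ennreal (?K w)))"
    by simp
  then have "ln (\<psi> (ennreal ?x)) \<le> (1 - t) * v + t * w"
    unfolding K[OF vw(1)] K[OF vw(2)] .
  then have "\<psi> (ennreal ?x) \<le> exp ((1 - t) * v + t * w)"
    using exp_le_cancel_iff[of "ln (\<psi> (ennreal ?x))"] pos[OF x0] by simp
  then have "gen_inv \<psi> (exp ((1 - t) * v + t * w)) \<le> ennreal ?x"
    unfolding gen_inv_def by (intro Inf_lower) simp
  then have "?K ((1 - t) * v + t * w) \<le> enn2real (ennreal ?x)"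
    by (rule enn2real_mono) simp
  then show "?K ((1 - t) *\<^sub>R v + t *\<^sub>R w) \<le> (1 - t) * ?K v + t * ?K w"
    using x0 by simp
qed simp

section \<open>Ordered vectors\<close>

lemma order_stat_mono:
  assumes "mono_on {1..n} x" and "i \<in> {1..n}"
  shows "order_stat n x i = x i"
proof -
  have "mono_on (set [1..<n + 1]) x"
    using assms(1) by (simp add: atLeastLessThanSuc_atLeastAtMost del: upt_Suc)
  then have "sorted (map x [1..<n + 1])"
    by (intro sorted_map_mono sorted_upt)
  then have "order_stat n x i = map x [1..<n + 1] ! (i - 1)"
    unfolding order_stat_def by (simp only: sorted_sort_id)
  also have "\<dots> = x (1 + (i - 1))"
    by (rule nth_map_upt) (use assms(2) in auto)
  finally show ?thesis using assms(2) by simp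
qed

lemma order_stat_rev: "order_stat n (\<lambda>k. x (n + 1 - k)) = order_stat n x"
proof -
  have "map (\<lambda>k. x (n + 1 - k)) [1..<n + 1] = rev (map x [1..<n + 1])"
    by (rule nth_equalityI) (auto simp: rev_nth Suc_diff_Suc simp del: upt_Suc)
  then have "sort (map (\<lambda>k. x (n + 1 - k)) [1..<n + 1]) = sort (map x [1..<n + 1])"
    by (metis mset_rev sorted_list_of_multiset_mset)
  then show ?thesis by (simp add: order_stat_def fun_eq_iff del: upt_Suc)
qed

lemma archimedean_copula_rev:
  "archimedean_copula n \<psi> (\<lambda>k. u (n + 1 - k)) = archimedean_copula n \<psi> u"
  unfolding archimedean_copula_def
  by (subst sum.atLeastAtMost_rev) (auto intro!: sum.cong arg_cong[of _ _ \<psi>])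

lemma D_plus_rev:
  assumes "x \<in> D_plus n" shows "(\<lambda>k. x (n + 1 - k)) \<in> E_plus n"
proof -
  have "x (n + 1 - i) \<le> x (n + 1 - j)" if "i \<in> {1..n}" "j \<in> {1..n}" "i \<le> j" for i j
    using assms that monotone_onD[of "{1..n}" "(\<le>)" "(\<ge>)" x "n + 1 - j" "n + 1 - i"]
    by (auto simp: D_plus_def)
  moreover have "0 < x (n + 1 - i)" if "i \<in> {1..n}" for i
  proof -
    have "n + 1 - i \<in> {1..n}" using that by auto
    then show ?thesis using assms by (simp only: D_plus_def mem_Collect_eq)
  qed
  ultimately show ?thesis
    unfolding E_plus_def by (auto intro!: mono_onI)
qed

lemma D_plus_inverse: "x \<in> D_plus n \<Longrightarrow> (\<lambda>k. 1 / x k) \<in> E_plus n"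
  unfolding D_plus_def E_plus_def monotone_on_def by (auto simp: frac_le)

lemma E_plus_inverse: "x \<in> E_plus n \<Longrightarrow> (\<lambda>k. 1 / x k) \<in> D_plus n"
  unfolding D_plus_def E_plus_def monotone_on_def by (auto simp: frac_le)

section \<open>Comparison of scale vectors\<close>

text \<open>The function \<open>\<theta>\<close> stands for \<open>ln u\<close> or \<open>- 1 / u\<close>, and \<open>p, q\<close> for the arguments \<open>a k * z k\<close> and
\<open>a k * w k\<close> of \<open>H\<close>. Each difference \<open>\<theta> (p k) - \<theta> (q k)\<close> splits into a multiple \<open>\<alpha> k\<close>, coming from
the locations, of a difference in which only the scales occur. All slopes are taken at \<open>q\<close>, and
they are monotone in \<open>k\<close> because \<open>q\<close> is increasing; \<open>p 1 \<le> q 1\<close> keeps \<open>H\<close> positive at all \<open>q k\<close> once it is positive at \<open>p 1\<close>.\<close>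
lemma (in distribution_with_density) archimedean_copula_le_of_partial_sums:
  fixes R \<theta> :: "real \<Rightarrow> real" and p q \<alpha> x y :: "nat \<Rightarrow> real"
  assumes gen: "archimedean_generator n \<psi>" and n: "n \<ge> 2"
    and lc: "log_convex_on {0..} (\<lambda>x. \<psi> (ennreal x))"
    and R: "antimono_on {u. 0 < u \<and> 0 < H u} R" "\<And>u. 0 < u \<Longrightarrow> 0 < H u \<Longrightarrow> 0 \<le> R u"
    and tan: "\<And>u v. 0 < u \<Longrightarrow> 0 < H u \<Longrightarrow> 0 < v \<Longrightarrow> 0 < H v \<Longrightarrow>
                ln (H v) - ln (H u) \<le> R u * (\<theta> v - \<theta> u)"
    and pq: "\<And>k. k \<in> {1..n} \<Longrightarrow> 0 < p k" "mono_on {1..n} q" "p 1 \<le> q 1"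
    and \<theta>: "\<And>k. k \<in> {1..n} \<Longrightarrow> \<theta> (p k) - \<theta> (q k) = \<alpha> k * (x k - y k)"
    and \<alpha>: "antimono_on {1..n} \<alpha>" "\<And>k. k \<in> {1..n} \<Longrightarrow> 0 \<le> \<alpha> k"
    and xy: "\<And>j. j \<in> {1..n} \<Longrightarrow> (\<Sum>i=1..j. x i) \<le> (\<Sum>i=1..j. y i)"
  shows "archimedean_copula n \<psi> (\<lambda>k. H (p k)) \<le> archimedean_copula n \<psi> (\<lambda>k. H (q k))"
proof (cases "\<exists>k\<in>{1..n}. H (p k) = 0")
  case True
  then obtain k where "k \<in> {1..n}" "H (p k) = 0" by blast
  then have "archimedean_copula n \<psi> (\<lambda>k. H (p k)) = 0"
    by (rule archimedean_copula_eq_0[OF gen n])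
  moreover have "0 \<le> \<psi> s" for s
    using gen by (simp add: archimedean_generator_def image_subset_iff)
  ultimately show ?thesis by (simp add: archimedean_copula_def)
next
  case False
  have p: "0 < p k" "0 < H (p k)" "ln (H (p k)) \<le> 0" if k: "k \<in> {1..n}" for k
  proof -
    show "0 < p k" using pq(1)[OF k] .
    have "H (p k) \<noteq> 0" using False k by blast
    then show "0 < H (p k)" using bounds[of "p k"] by simp
    then show "ln (H (p k)) \<le> 0" using bounds[of "p k"] by simp
  qed
  have q1: "p 1 \<le> q k" if "k \<in> {1..n}" for k
    using that mono_onD[OF pq(2), of 1 k] pq(3) by simp
  have q: "0 < q k" "0 < H (q k)" "ln (H (q k)) \<le> 0" if "k \<in> {1..n}" for k
  proof -
    show "0 < q k" using q1[OF that] p(1)[of 1] n by simp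
    show "0 < H (q k)"
      using monoD[OF mono_H q1[OF that]] p(2)[of 1] n by simp
    then show "ln (H (q k)) \<le> 0" using bounds[of "q k"] by simp
  qed
  \<comment> \<open>Off the boundary all inverses are finite, and the sums can be compared in the reals.\<close>
  define K where "K v = enn2real (gen_inv \<psi> (exp v))" for v
  have finite: "gen_inv \<psi> (exp v) < \<infinity>" if "v \<le> 0" for v
    using gen_inv_finite[OF gen n, of "exp v"] that by simp
  have "antimono_on {..0} K"
    unfolding K_def by (rule monotone_onI) (auto intro!: enn2real_mono gen_inv_antimono finite[simplified])
  moreover have "convex_on {..0} K"
    unfolding K_def by (rule gen_inv_exp_convex[OF gen n lc])
  ultimately obtain c where c: "\<And>v. v \<le> 0 \<Longrightarrow> c v \<le> 0" "mono_on {..0} c"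
    "\<And>v s. v \<le> 0 \<Longrightarrow> s \<le> 0 \<Longrightarrow> c v * (s - v) \<le> K s - K v"
    using convex_decreasing_subgradient by metis
  define v w where "v k = ln (H (p k))" and "w k = ln (H (q k))" for k
  \<comment> \<open>The product of the slope of \<open>K\<close>, the slope of \<open>ln \<circ> H\<close> in \<open>\<theta>\<close>, and the location factor.\<close>
  define d where "d k = - c (w k) * R (q k) * \<alpha> k" for k
  have w_mono: "w i \<le> w j" if "i \<in> {1..n}" "j \<in> {1..n}" "i \<le> j" for i j
    using that q monoD[OF mono_H, of "q i" "q j"] mono_onD[OF pq(2), of i j] by (simp add: w_def)
  have cR: "0 \<le> - c (w k)" "0 \<le> R (q k)" if "k \<in> {1..n}" for k
    using c(1) R(2) q that unfolding w_def by (metis neg_0_le_iff_le)+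
  have "0 \<le> (\<Sum>k=1..n. d k * (y k - x k))"
  proof (rule sum_mult_nonneg_of_partial_sums)
    show "0 \<le> d k" if "k \<in> {1..n}" for k
      unfolding d_def using that by (intro mult_nonneg_nonneg cR \<alpha>(2))
    show "antimono_on {1..n} d"
    proof (rule monotone_onI)
      fix i j assume ij: "i \<in> {1..n}" "j \<in> {1..n}" "i \<le> j"
      have "- c (w j) \<le> - c (w i)"
        using ij q w_mono[OF ij] mono_onD[OF c(2), of "w i" "w j"] by (simp add: w_def)
      moreover have "R (q j) \<le> R (q i)"
        using ij q monotone_onD[OF R(1), of "q i" "q j"] mono_onD[OF pq(2), of i j] by simp
      moreover have "\<alpha> j \<le> \<alpha> i" using monotone_onD[OF \<alpha>(1) ij] .
      ultimately show "d j \<le> d i"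
        unfolding d_def using ij by (intro mult_mono mult_nonneg_nonneg cR \<alpha>(2))
    qed
    show "0 \<le> (\<Sum>i=1..j. y i - x i)" if "j \<in> {1..n}" for j
      using xy[OF that] by (simp add: sum_subtractf)
  qed
  also have "\<dots> \<le> (\<Sum>k=1..n. K (v k) - K (w k))"
  proof (rule sum_mono)
    fix k assume k: "k \<in> {1..n}"
    \<comment> \<open>Since \<open>c\<close> is nonpositive, the upper bound on \<open>v k - w k\<close> becomes a lower bound.\<close>
    have "v k - w k \<le> R (q k) * (\<theta> (p k) - \<theta> (q k))"
      unfolding v_def w_def using p q k by (intro tan) auto
    then have "c (w k) * (R (q k) * (\<theta> (p k) - \<theta> (q k))) \<le> c (w k) * (v k - w k)"
      using cR[OF k] by (intro mult_left_mono_neg) simp_all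
    also have "\<dots> \<le> K (v k) - K (w k)"
      using p q k by (intro c(3)) (auto simp: v_def w_def)
    finally show "d k * (y k - x k) \<le> K (v k) - K (w k)"
      using \<theta>[OF k] by (simp add: d_def algebra_simps)
  qed
  finally have le: "(\<Sum>k=1..n. K (w k)) \<le> (\<Sum>k=1..n. K (v k))" by (simp add: sum_subtractf)
  have eq: "(\<Sum>k=1..n. gen_inv \<psi> (H (r k))) = ennreal (\<Sum>k=1..n. K (ln (H (r k))))"
    if "\<And>k. k \<in> {1..n} \<Longrightarrow> 0 < H (r k)" for r
  proof -
    have "(\<Sum>k=1..n. gen_inv \<psi> (H (r k))) = (\<Sum>k=1..n. ennreal (K (ln (H (r k)))))"
      using that bounds by (intro sum.cong) (auto simp: K_def gen_inv_finite[OF gen n, simplified])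
    then show ?thesis by (simp add: K_def)
  qed
  show ?thesis
    unfolding archimedean_copula_def
    using archimedean_generator_antimono[OF gen n] le eq[of p] eq[of q] p q
    by (auto intro!: antimonoD[of \<psi>] ennreal_leI simp: v_def w_def)
qed


text \<open>The two orders lead to the same argument. For the order by products, \<open>\<theta> = ln\<close> and the locations
cancel. For the order by sums of reciprocals, \<open>\<theta> u = - 1 / u\<close> and the locations leave the factor
\<open>1 / a k\<close>, which decreases because \<open>a\<close> increases.\<close>
lemma (in distribution_with_density) archimedean_copula_le_of_larger_E_plus:
  assumes gen: "archimedean_generator n \<psi>" and n: "n \<ge> 2"
    and lc: "log_convex_on {0..} (\<lambda>x. \<psi> (ennreal x))"
    and a: "a \<in> E_plus n" and z: "z \<in> E_plus n" and w: "w \<in> E_plus n"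
    and larger:
      "antimono_on {u. 0 < u \<and> 0 < H u} (\<lambda>u. u * rev_hazard h H u) \<and> p_larger n z w \<or>
       antimono_on {u. 0 < u \<and> 0 < H u} (\<lambda>u. u\<^sup>2 * rev_hazard h H u) \<and> rm_larger n z w"
  shows "archimedean_copula n \<psi> (\<lambda>k. H (a k * z k)) \<le> archimedean_copula n \<psi> (\<lambda>k. H (a k * w k))"
proof -
  have pos: "0 < a k" "0 < z k" "0 < w k" if "k \<in> {1..n}" for k
    using a z w that by (auto simp: E_plus_def)
  have os: "order_stat n z k = z k" "order_stat n w k = w k" if "k \<in> {1..n}" for k
    using z w that by (auto simp: E_plus_def intro!: order_stat_mono)
  have prod_mono: "mono_on {1..n} (\<lambda>k. a k * w k)"
  proof (rule mono_onI)
    fix i j assume ij: "i \<in> {1..n}" "j \<in> {1..n}" "i \<le> j"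
    have "a i \<le> a j" "w i \<le> w j"
      using a w ij by (auto simp: E_plus_def intro: mono_onD)
    then show "a i * w i \<le> a j * w j"
      using pos[OF ij(1)] pos[OF ij(2)] by (intro mult_mono) auto
  qed
  have R0: "0 \<le> rev_hazard h H u" for u
    using density_nonneg[of u] bounds[of u] by (simp add: rev_hazard_def)
  have 1: "1 \<in> {1..n}" using n by simp
  show ?thesis
    using larger
  proof (elim disjE conjE)
    assume anti: "antimono_on {u. 0 < u \<and> 0 < H u} (\<lambda>u. u * rev_hazard h H u)"
      and p: "p_larger n z w"
    have prod: "(\<Prod>i=1..j. z i) \<le> (\<Prod>i=1..j. w i)" if "j \<in> {1..n}" for j
      using p that os by (simp add: p_larger_def)
    show ?thesis
    proof (rule archimedean_copula_le_of_partial_sums[OF gen n lc, where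
          \<theta> = ln and \<alpha> = "\<lambda>_. 1" and x = "\<lambda>k. ln (z k)" and y = "\<lambda>k. ln (w k)", OF anti])
      show "ln (H v) - ln (H u) \<le> u * rev_hazard h H u * (ln v - ln u)"
        if "0 < u" "0 < H u" "0 < v" "0 < H v" for u v
        by (rule ln_tangent[OF _ _ _ anti]) (use that in \<open>auto intro!: derivative_eq_intros continuous_intros\<close>)
      show "a 1 * z 1 \<le> a 1 * w 1"
        using prod[OF 1] pos[OF 1] by simp
      show "ln (a k * z k) - ln (a k * w k) = 1 * (ln (z k) - ln (w k))" if "k \<in> {1..n}" for k
        using pos[OF that] by (simp add: ln_mult)
      show "(\<Sum>i=1..j. ln (z i)) \<le> (\<Sum>i=1..j. ln (w i))" if "j \<in> {1..n}" for j
      proof -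
        have "0 < z i" "0 < w i" if "i \<in> {1..j}" for i
          using \<open>j \<in> {1..n}\<close> that pos[of i] by auto
        note pos = this
        then have "0 < (\<Prod>i=1..j. z i)" by (intro prod_pos) blast
        then have "ln (\<Prod>i=1..j. z i) \<le> ln (\<Prod>i=1..j. w i)"
          using prod[OF that] by (intro ln_mono) auto
        moreover have "ln (\<Prod>i=1..j. z i) = (\<Sum>i=1..j. ln (z i))"
          by (intro ln_prod) (simp_all add: pos less_imp_neq[THEN not_sym])
        moreover have "ln (\<Prod>i=1..j. w i) = (\<Sum>i=1..j. ln (w i))"
          by (intro ln_prod) (simp_all add: pos less_imp_neq[THEN not_sym])
        ultimately show ?thesis by simp
      qed
    qed (use pos R0 prod_mono in \<open>auto intro: monotone_onI\<close>)
  next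
    assume anti: "antimono_on {u. 0 < u \<and> 0 < H u} (\<lambda>u. u\<^sup>2 * rev_hazard h H u)"
      and rm: "rm_larger n z w"
    have sum: "(\<Sum>i=1..j. 1 / w i) \<le> (\<Sum>i=1..j. 1 / z i)" if "j \<in> {1..n}" for j
      using rm that os by (simp add: rm_larger_def)
    show ?thesis
    proof (rule archimedean_copula_le_of_partial_sums[OF gen n lc, where
          \<theta> = "\<lambda>u. - 1 / u" and \<alpha> = "\<lambda>k. 1 / a k" and
          x = "\<lambda>k. - 1 / z k" and y = "\<lambda>k. - 1 / w k", OF anti])
      show "ln (H v) - ln (H u) \<le> u\<^sup>2 * rev_hazard h H u * (- 1 / v - - 1 / u)"
        if "0 < u" "0 < H u" "0 < v" "0 < H v" for u v
        by (rule ln_tangent[OF _ _ _ anti])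
           (use that in \<open>auto intro!: derivative_eq_intros continuous_intros simp: power2_eq_square\<close>)
      show "a 1 * z 1 \<le> a 1 * w 1"
        using sum[OF 1] pos[OF 1] by (simp add: field_simps)
      show "- 1 / (a k * z k) - - 1 / (a k * w k) = 1 / a k * (- 1 / z k - - 1 / w k)"
        if "k \<in> {1..n}" for k
        using pos[OF that] by (simp add: field_simps)
      show "(\<Sum>i=1..j. - 1 / z i) \<le> (\<Sum>i=1..j. - 1 / w i)" if "j \<in> {1..n}" for j
        using sum[OF that] by (simp add: sum_negf)
      show "antimono_on {1..n} (\<lambda>k. 1 / a k)"
        using E_plus_inverse[OF a] by (simp add: D_plus_def)
    qed (use pos R0 prod_mono in \<open>auto simp: less_imp_le\<close>)
  qed
qed

text \<open>Reversing the indices changes neither the copula nor the order statistics.\<close>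
lemma (in distribution_with_density) archimedean_copula_le_of_larger:
  assumes gen: "archimedean_generator n \<psi>" and n: "n \<ge> 2"
    and lc: "log_convex_on {0..} (\<lambda>x. \<psi> (ennreal x))"
    and ordered: "a \<in> E_plus n \<and> z \<in> E_plus n \<and> w \<in> E_plus n \<or>
                  a \<in> D_plus n \<and> z \<in> D_plus n \<and> w \<in> D_plus n"
    and larger:
      "antimono_on {u. 0 < u \<and> 0 < H u} (\<lambda>u. u * rev_hazard h H u) \<and> p_larger n z w \<or>
       antimono_on {u. 0 < u \<and> 0 < H u} (\<lambda>u. u\<^sup>2 * rev_hazard h H u) \<and> rm_larger n z w"
  shows "archimedean_copula n \<psi> (\<lambda>k. H (a k * z k)) \<le> archimedean_copula n \<psi> (\<lambda>k. H (a k * w k))"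
  using ordered
proof (elim disjE conjE)
  assume "a \<in> E_plus n" "z \<in> E_plus n" "w \<in> E_plus n"
  then show ?thesis using archimedean_copula_le_of_larger_E_plus[OF gen n lc _ _ _ larger] by blast
next
  assume D: "a \<in> D_plus n" "z \<in> D_plus n" "w \<in> D_plus n"
  have "p_larger n (\<lambda>k. z (n + 1 - k)) (\<lambda>k. w (n + 1 - k)) = p_larger n z w"
    "rm_larger n (\<lambda>k. z (n + 1 - k)) (\<lambda>k. w (n + 1 - k)) = rm_larger n z w"
    by (simp_all only: p_larger_def rm_larger_def order_stat_rev)
  then have "archimedean_copula n \<psi> (\<lambda>k. H (a (n + 1 - k) * z (n + 1 - k)))
      \<le> archimedean_copula n \<psi> (\<lambda>k. H (a (n + 1 - k) * w (n + 1 - k)))"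
    using larger
    by (intro archimedean_copula_le_of_larger_E_plus[OF gen n lc] D_plus_rev D) simp_all
  then show ?thesis
    using archimedean_copula_rev[of n \<psi> "\<lambda>k. H (a k * z k)"]
      archimedean_copula_rev[of n \<psi> "\<lambda>k. H (a k * w k)"] by simp
qed

section \<open>Distribution of the sample maximum\<close>

lemma cdf_sample_max:
  assumes "n \<ge> 1" and U: "\<And>k. k \<in> {1..n} \<Longrightarrow> U k \<in> borel_measurable M"
  shows "cdf (distr M borel (sample_max n U)) t = measure M {w \<in> space M. \<forall>k\<in>{1..n}. U k w \<le> t}"
    and "sample_max n U \<in> borel_measurable M"
proof -
  show meas: "sample_max n U \<in> borel_measurable M"
    unfolding sample_max_def[abs_def] using U by (intro borel_measurable_Max) auto
  have "sample_max n U -` {..t} \<inter> space M = {w \<in> space M. \<forall>k\<in>{1..n}. U k w \<le> t}"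
    using \<open>n \<ge> 1\<close> by (auto simp: sample_max_def Max_le_iff)
  then show "cdf (distr M borel (sample_max n U)) t = measure M {w \<in> space M. \<forall>k\<in>{1..n}. U k w \<le> t}"
    using meas by (simp add: cdf_def measure_distr)
qed

lemma cdf_sample_max_LS:
  assumes M: "prob_space M" and n: "n \<ge> 1"
    and LS: "\<And>k. k \<in> {1..n} \<Longrightarrow> LS M (U k) (l k) (s k) F"
    and cop: "has_archimedean_copula M n U \<psi>"
  shows "(\<And>k. k \<in> {1..n} \<Longrightarrow> l k < t) \<Longrightarrow> cdf (distr M borel (sample_max n U)) t
           = archimedean_copula n \<psi> (\<lambda>k. F ((t - l k) / s k))"
    and "k \<in> {1..n} \<Longrightarrow> t < l k \<Longrightarrow> cdf (distr M borel (sample_max n U)) t = 0"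
proof -
  interpret M: prob_space M by fact
  have U: "U k \<in> borel_measurable M" if "k \<in> {1..n}" for k
    using LS[OF that] by (simp add: LS_def)
  have eq: "cdf (distr M borel (sample_max n U)) t
      = archimedean_copula n \<psi> (\<lambda>k. cdf (distr M borel (U k)) t)"
    using cop cdf_sample_max(1)[OF n U] by (simp add: has_archimedean_copula_def)
  show "cdf (distr M borel (sample_max n U)) t
      = archimedean_copula n \<psi> (\<lambda>k. F ((t - l k) / s k))" if "\<And>k. k \<in> {1..n} \<Longrightarrow> l k < t"
    unfolding eq archimedean_copula_def using LS that
    by (intro arg_cong[of _ _ \<psi>] sum.cong) (auto simp: LS_def)
  show "cdf (distr M borel (sample_max n U)) t = 0" if k: "k \<in> {1..n}" "t < l k"
  proof -
    have "measure M {w \<in> space M. \<forall>k\<in>{1..n}. U k w \<le> t} \<le> measure M (U k -` {..t} \<inter> space M)"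
      using k U[OF k(1)] by (intro M.finite_measure_mono) auto
    also have "\<dots> = cdf (distr M borel (U k)) t"
      using U[OF k(1)] by (simp add: cdf_def measure_distr)
    also have "\<dots> = 0" using LS[OF k(1)] k(2) by (simp add: LS_def)
    finally show ?thesis
      using cdf_sample_max(1)[OF n U] by (simp add: measure_le_0_iff)
  qed
qed

text \<open>Only times above all locations need the copulas. Below some location the first distribution function
vanishes, and the largest location itself is reached by right-continuity.\<close>
lemma st_ge_sample_max:
  assumes M: "prob_space M" and N: "prob_space N" and n: "n \<ge> 1"
    and X: "\<And>k. k \<in> {1..n} \<Longrightarrow> LS M (Xs k) (l k) (\<sigma> k) F" "has_archimedean_copula M n Xs \<psi>1"
    and Y: "\<And>k. k \<in> {1..n} \<Longrightarrow> LS N (Ys k) (l k) (\<xi> k) G" "has_archimedean_copula N n Ys \<psi>2"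
    and le: "\<And>t. (\<And>k. k \<in> {1..n} \<Longrightarrow> l k < t) \<Longrightarrow>
      archimedean_copula n \<psi>1 (\<lambda>k. F ((t - l k) / \<sigma> k))
        \<le> archimedean_copula n \<psi>2 (\<lambda>k. G ((t - l k) / \<xi> k))"
  shows "st_ge M (sample_max n Xs) N (sample_max n Ys)"
  unfolding st_ge_def
proof
  fix t
  let ?X = "distr M borel (sample_max n Xs)" and ?Y = "distr N borel (sample_max n Ys)"
  interpret X: real_distribution ?X
    using X(1) n by (intro prob_space.real_distribution_distr M cdf_sample_max(2)) (auto simp: LS_def)
  interpret Y: real_distribution ?Y
    using Y(1) n by (intro prob_space.real_distribution_distr N cdf_sample_max(2)) (auto simp: LS_def)
  have above: "cdf ?X s \<le> cdf ?Y s" if "\<And>k. k \<in> {1..n} \<Longrightarrow> l k < s" for s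
    using le[OF that] cdf_sample_max_LS(1)[OF M n X that] cdf_sample_max_LS(1)[OF N n Y that] by simp
  show "cdf ?X t \<le> cdf ?Y t"
  proof (cases "\<exists>k\<in>{1..n}. t < l k")
    case True
    then obtain k where "k \<in> {1..n}" "t < l k" by blast
    then show ?thesis using cdf_sample_max_LS(2)[OF M n X] Y.cdf_nonneg by simp
  next
    case False
    have "eventually (\<lambda>s. t < s) (at_right t)" by (rule eventually_at_right_less)
    then have "eventually (\<lambda>s. cdf ?X s \<le> cdf ?Y s) (at_right t)"
      by eventually_elim (use False above in force)
    moreover have "(cdf ?X \<longlongrightarrow> cdf ?X t) (at_right t)" "(cdf ?Y \<longlongrightarrow> cdf ?Y t) (at_right t)"
      using X.cdf_is_right_cont Y.cdf_is_right_cont by (simp_all add: continuous_within)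
    ultimately show ?thesis
      by (intro tendsto_le[OF trivial_limit_at_right_real])
  qed
qed


section \<open>Stochastic comparison of sample maxima\<close>

theorem theorem17:
  fixes n :: nat
    and P :: "'p measure" and X :: "'p \<Rightarrow> real" and f F :: "real \<Rightarrow> real"
    and Q :: "'q measure" and Y :: "'q \<Rightarrow> real" and g G :: "real \<Rightarrow> real"
    and M :: "'a measure" and Xs :: "nat \<Rightarrow> 'a \<Rightarrow> real"
    and N :: "'b measure" and Ys :: "nat \<Rightarrow> 'b \<Rightarrow> real"
    and l \<sigma> \<xi> :: "nat \<Rightarrow> real"
    and \<psi>1 \<psi>2 :: "ennreal \<Rightarrow> real"
  assumes "n \<ge> 2"
    and "prob_space P" and "prob_space Q" and "prob_space M" and "prob_space N"
    and "\<And>u. 0 \<le> f u" and "distributed P lborel X (\<lambda>u. ennreal (f u))"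
    and "F = cdf (distr P borel X)"
    and "\<And>u. 0 \<le> g u" and "distributed Q lborel Y (\<lambda>u. ennreal (g u))"
    and "G = cdf (distr Q borel Y)"
    and "archimedean_generator n \<psi>1" and "archimedean_generator n \<psi>2"
    and "\<And>i. i \<in> {1..n} \<Longrightarrow> LS M (Xs i) (l i) (\<sigma> i) F"
    and "has_archimedean_copula M n Xs \<psi>1"
    and "\<And>i. i \<in> {1..n} \<Longrightarrow> LS N (Ys i) (l i) (\<xi> i) G"
    and "has_archimedean_copula N n Ys \<psi>2"
    and "(l \<in> D_plus n \<and> \<sigma> \<in> D_plus n \<and> \<xi> \<in> D_plus n) \<or>
         (l \<in> E_plus n \<and> \<sigma> \<in> E_plus n \<and> \<xi> \<in> E_plus n)"
    and "super_additive (gen_inv \<psi>2 \<circ> \<psi>1)"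
    and "log_convex_on {0..} (\<lambda>x. \<psi>1 (ennreal x)) \<or>
         log_convex_on {0..} (\<lambda>x. \<psi>2 (ennreal x))"
    and "st_ge P X Q Y"
  shows "(antimono_on {u. 0 < u \<and> 0 < F u} (\<lambda>u. u * rev_hazard f F u) \<or>
          antimono_on {u. 0 < u \<and> 0 < G u} (\<lambda>u. u * rev_hazard g G u) \<longrightarrow>
          p_larger n (\<lambda>i. 1 / \<sigma> i) (\<lambda>i. 1 / \<xi> i) \<longrightarrow>
          st_ge M (sample_max n Xs) N (sample_max n Ys)) \<and>
         (antimono_on {u. 0 < u \<and> 0 < F u} (\<lambda>u. u\<^sup>2 * rev_hazard f F u) \<or>
          antimono_on {u. 0 < u \<and> 0 < G u} (\<lambda>u. u\<^sup>2 * rev_hazard g G u) \<longrightarrow>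
          rm_larger n (\<lambda>i. 1 / \<sigma> i) (\<lambda>i. 1 / \<xi> i) \<longrightarrow>
          st_ge M (sample_max n Xs) N (sample_max n Ys))"
proof -
  note [simp] = \<open>F = cdf (distr P borel X)\<close> \<open>G = cdf (distr Q borel Y)\<close>
  interpret F: distribution_with_density f F
    using assms by (simp add: distribution_with_density_cdf)
  interpret G: distribution_with_density g G
    using assms by (simp add: distribution_with_density_cdf)
  have FG: "F u \<le> G u" for u
    using \<open>st_ge P X Q Y\<close> by (simp add: st_ge_def)
  let ?z = "\<lambda>k. 1 / \<sigma> k" and ?w = "\<lambda>k. 1 / \<xi> k"
  let ?C = "archimedean_copula n"
  \<comment> \<open>One of the two baselines, with one of the two weights, is enough for both parts.\<close>
  have "st_ge M (sample_max n Xs) N (sample_max n Ys)"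
    if larger: "\<exists>(h, H)\<in>{(f, F), (g, G)}.
      antimono_on {u. 0 < u \<and> 0 < H u} (\<lambda>u. u * rev_hazard h H u) \<and> p_larger n ?z ?w \<or>
      antimono_on {u. 0 < u \<and> 0 < H u} (\<lambda>u. u\<^sup>2 * rev_hazard h H u) \<and> rm_larger n ?z ?w"
  proof (rule st_ge_sample_max)
    fix t assume t: "\<And>k. k \<in> {1..n} \<Longrightarrow> l k < t"
    define a where "a k = t - l k" for k
    have ordered: "a \<in> E_plus n \<and> ?z \<in> E_plus n \<and> ?w \<in> E_plus n \<or>
        a \<in> D_plus n \<and> ?z \<in> D_plus n \<and> ?w \<in> D_plus n"
    proof -
      have "a \<in> E_plus n" if "l \<in> D_plus n"
        using that t unfolding a_def D_plus_def E_plus_def monotone_on_def by auto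
      moreover have "a \<in> D_plus n" if "l \<in> E_plus n"
        using that t unfolding a_def D_plus_def E_plus_def monotone_on_def by auto
      ultimately show ?thesis
        using assms(18) D_plus_inverse E_plus_inverse by blast
    qed
    from larger obtain h H where hH: "(h, H) = (f, F) \<or> (h, H) = (g, G)"
      and larger': "antimono_on {u. 0 < u \<and> 0 < H u} (\<lambda>u. u * rev_hazard h H u) \<and> p_larger n ?z ?w \<or>
        antimono_on {u. 0 < u \<and> 0 < H u} (\<lambda>u. u\<^sup>2 * rev_hazard h H u) \<and> rm_larger n ?z ?w"
      by blast
    interpret H: distribution_with_density h H
      using hH F.distribution_with_density_axioms G.distribution_with_density_axioms by auto
    have FHG: "F u \<le> H u" "H u \<le> G u" for u using hH FG by auto
    obtain \<psi> where \<psi>: "\<psi> = \<psi>1 \<or> \<psi> = \<psi>2" and lc: "log_convex_on {0..} (\<lambda>x. \<psi> (ennreal x))"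
      using assms(20) by blast
    have gen: "archimedean_generator n \<psi>" using \<psi> assms(12,13) by blast
    have C12: "?C \<psi>1 u \<le> ?C \<psi>2 u" if "\<And>k. u k \<in> {0..1}" for u
      using archimedean_copula_le_of_super_additive[OF assms(12,13,1,19)] that by blast
    \<comment> \<open>The scales change in the middle of the chain, after the change to \<open>\<psi>\<close> and \<open>H\<close> and before the
      change to \<open>G\<close> and \<open>\<psi>2\<close>.\<close>
    have "?C \<psi>1 (\<lambda>k. F (a k * ?z k)) \<le> ?C \<psi> (\<lambda>k. F (a k * ?z k))"
      using \<psi> C12[of "\<lambda>k. F (a k * ?z k)"] F.bounds by auto
    also have "\<dots> \<le> ?C \<psi> (\<lambda>k. H (a k * ?z k))"
      by (intro archimedean_copula_mono[OF gen assms(1)] FHG)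
    also have "\<dots> \<le> ?C \<psi> (\<lambda>k. H (a k * ?w k))"
      by (rule H.archimedean_copula_le_of_larger[OF gen assms(1) lc ordered larger'])
    also have "\<dots> \<le> ?C \<psi> (\<lambda>k. G (a k * ?w k))"
      by (intro archimedean_copula_mono[OF gen assms(1)] FHG)
    also have "\<dots> \<le> ?C \<psi>2 (\<lambda>k. G (a k * ?w k))"
      using \<psi> C12[of "\<lambda>k. G (a k * ?w k)"] G.bounds by auto
    finally show "?C \<psi>1 (\<lambda>k. F ((t - l k) / \<sigma> k)) \<le> ?C \<psi>2 (\<lambda>k. G ((t - l k) / \<xi> k))"
      by (simp add: a_def)
  qed (use assms in auto)
  then show ?thesis by blast
qed

end
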